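(* Let $K$ be a field of characteristic zero. Suppose that the unital $K$-algebra $E$ has an ideal $M_E$ which is isomorphic to $M_\infty(K)$. Let $i:M_E\to E$ be the inclusion and let $\iota:M_E\to \mathrm{B}(K)$ be the natural embedding, i.e. the composition of the given isomorphism $M_E\cong M_\infty(K)$ with the inclusion $M_\infty(K)\subseteq \mathrm{B}(K)$. Then there exists a unique homomorphism $\phi:E\to \mathrm{B}(K)$ such that $\phi\circ i=\iota$. Furthermore, $\phi$ is injective if and only if $M_E$ is a faithful ideal of $E$.
   Context: $\mathbb{Z}^+$ denotes the positive integers. $\mathrm{B}(K)$ is the unital $K$-algebra of $\mathbb{Z}^+\times\mathbb{Z}^+$ matrices over $K$ with only finitely many nonzero entries in each row and each column. $M_\infty(K)$ is the (non-unital) ideal of $\mathrm{B}(K)$ of matrices with only finitely many nonzero entries. Homomorphisms between unital algebras are unital. A two-sided ideal $I$ of an algebra $E$ is faithful if $aI=\{0\}$ implies $a=0$ and $Ib=\{0\}$ implies $b=0$ (for $a,b\in E$). *)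

theory Defs
  imports Complex_Main "HOL-Library.Groups_Big_Fun"
begin

typedef pos = "{n :: nat. 0 < n}"
  by auto

section \<open>The algebra \<open>B(K)\<close> and its ideal of finite matrices\<close>

typedef (overloaded) 'k rcf_matrix =
  "{A :: pos \<Rightarrow> pos \<Rightarrow> 'k::zero.
      (\<forall>i. finite {j. A i j \<noteq> 0}) \<and> (\<forall>j. finite {i. A i j \<noteq> 0})}"
  morphisms entry Rcf_Matrix
  by (rule exI[of _ "\<lambda>_ _. 0"]) simp

setup_lifting type_definition_rcf_matrix

lemma finite_row: "finite {j. entry A i j \<noteq> 0}"
  and finite_col: "finite {i. entry A i j \<noteq> 0}"
  using entry[of A] by auto

lemma rcf_matrix_eqI: "(\<And>i j. entry A i j = entry B i j) \<Longrightarrow> A = B"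
  by (metis entry_inject ext)

text \<open>
  \<open>Sum_any\<close> is the sum over the whole index type of a function with finite support.
  In the product below the support is finite because the rows of \<open>A\<close> are.
\<close>

lemma rcf_mult_aux:
  fixes A B :: "pos \<Rightarrow> pos \<Rightarrow> 'k::semiring_0"
  assumes A: "(\<forall>i. finite {j. A i j \<noteq> 0}) \<and> (\<forall>j. finite {i. A i j \<noteq> 0})"
    and B: "(\<forall>i. finite {j. B i j \<noteq> 0}) \<and> (\<forall>j. finite {i. B i j \<noteq> 0})"
  shows "(\<forall>i. finite {j. Sum_any (\<lambda>k. A i k * B k j) \<noteq> 0}) \<and>
         (\<forall>j. finite {i. Sum_any (\<lambda>k. A i k * B k j) \<noteq> 0})"
proof -
  have nz: "\<exists>k. A i k \<noteq> 0 \<and> B k j \<noteq> 0" if "Sum_any (\<lambda>k. A i k * B k j) \<noteq> 0" for i j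
    using that by (rule Sum_any.not_neutral_obtains_not_neutral) (blast dest: mult_not_zero)
  have "finite {j. Sum_any (\<lambda>k. A i k * B k j) \<noteq> 0}" for i
    by (rule finite_subset[of _ "\<Union>k\<in>{k. A i k \<noteq> 0}. {j. B k j \<noteq> 0}"]) (use A B in \<open>auto dest!: nz\<close>)
  moreover have "finite {i. Sum_any (\<lambda>k. A i k * B k j) \<noteq> 0}" for j
    by (rule finite_subset[of _ "\<Union>k\<in>{k. B k j \<noteq> 0}. {i. A i k \<noteq> 0}"]) (use A B in \<open>auto dest!: nz\<close>)
  ultimately show ?thesis by blast
qed

instantiation rcf_matrix :: (ring_1) ring_1
begin

lift_definition zero_rcf_matrix :: "'a rcf_matrix" is "\<lambda>_ _. 0" by simp

lift_definition one_rcf_matrix :: "'a rcf_matrix" is "\<lambda>i j. if i = j then 1 else 0" by simp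

lift_definition plus_rcf_matrix :: "'a rcf_matrix \<Rightarrow> 'a rcf_matrix \<Rightarrow> 'a rcf_matrix"
  is "\<lambda>A B i j. A i j + B i j"
proof -
  fix A B :: "pos \<Rightarrow> pos \<Rightarrow> 'a"
  assume A: "(\<forall>i. finite {j. A i j \<noteq> 0}) \<and> (\<forall>j. finite {i. A i j \<noteq> 0})"
    and B: "(\<forall>i. finite {j. B i j \<noteq> 0}) \<and> (\<forall>j. finite {i. B i j \<noteq> 0})"
  have "finite {j. A i j + B i j \<noteq> 0}" for i
    by (rule finite_subset[of _ "{j. A i j \<noteq> 0} \<union> {j. B i j \<noteq> 0}"]) (use A B in auto)
  moreover have "finite {i. A i j + B i j \<noteq> 0}" for j
    by (rule finite_subset[of _ "{i. A i j \<noteq> 0} \<union> {i. B i j \<noteq> 0}"]) (use A B in auto)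
  ultimately show "(\<forall>i. finite {j. A i j + B i j \<noteq> 0}) \<and> (\<forall>j. finite {i. A i j + B i j \<noteq> 0})"
    by blast
qed

lift_definition uminus_rcf_matrix :: "'a rcf_matrix \<Rightarrow> 'a rcf_matrix"
  is "\<lambda>A i j. - A i j" by simp

definition minus_rcf_matrix :: "'a rcf_matrix \<Rightarrow> 'a rcf_matrix \<Rightarrow> 'a rcf_matrix"
  where "A - B = A + - B" for A B :: "'a rcf_matrix"

lift_definition times_rcf_matrix :: "'a rcf_matrix \<Rightarrow> 'a rcf_matrix \<Rightarrow> 'a rcf_matrix"
  is "\<lambda>A B i j. Sum_any (\<lambda>k. A i k * B k j)"
  by (rule rcf_mult_aux)

lemmas entry_simps = zero_rcf_matrix.rep_eq one_rcf_matrix.rep_eq plus_rcf_matrix.rep_eq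
  uminus_rcf_matrix.rep_eq times_rcf_matrix.rep_eq

lemma entry_times_sum:
  fixes A B :: "'a rcf_matrix"
  assumes "finite S" "{k. entry A i k \<noteq> 0} \<subseteq> S"
  shows "entry (A * B) i j = (\<Sum>k\<in>S. entry A i k * entry B k j)"
  unfolding times_rcf_matrix.rep_eq
  by (rule Sum_any.expand_superset[OF assms(1)]) (use assms(2) in auto)

lemma entry_times_row:
  fixes A B :: "'a rcf_matrix"
  shows "entry (A * B) i j = (\<Sum>k | entry A i k \<noteq> 0. entry A i k * entry B k j)"
  by (rule entry_times_sum[OF finite_row order_refl])

instance
proof
  fix A B C :: "'a rcf_matrix"
  show "A + B + C = A + (B + C)" by (rule rcf_matrix_eqI) (simp add: entry_simps add.assoc)
  show "A + B = B + A" by (rule rcf_matrix_eqI) (simp add: entry_simps add.commute)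
  show "0 + A = A" by (rule rcf_matrix_eqI) (simp add: entry_simps)
  show "- A + A = 0" by (rule rcf_matrix_eqI) (simp add: entry_simps)
  show "A - B = A + - B" by (rule minus_rcf_matrix_def)
  show "(0::'a rcf_matrix) \<noteq> 1"
  proof
    assume "(0::'a rcf_matrix) = 1"
    then have "entry (0::'a rcf_matrix) i i = entry 1 i i" for i by simp
    then show False by (simp add: entry_simps)
  qed
  show "1 * A = A"
  proof (rule rcf_matrix_eqI)
    fix i j
    have "entry (1 * A) i j = (\<Sum>k\<in>{i}. entry 1 i k * entry A k j)"
      by (rule entry_times_sum) (auto simp: entry_simps)
    then show "entry (1 * A) i j = entry A i j" by (simp add: entry_simps)
  qed
  show "A * 1 = A"
  proof (rule rcf_matrix_eqI)
    fix i j
    have "entry (A * 1) i j = (\<Sum>k\<in>insert j {k. entry A i k \<noteq> 0}. entry A i k * entry 1 k j)"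
      by (rule entry_times_sum) (auto simp: finite_row)
    also have "\<dots> = (\<Sum>k\<in>insert j {k. entry A i k \<noteq> 0}. if k = j then entry A i k else 0)"
      by (rule sum.cong) (auto simp: entry_simps)
    also have "\<dots> = entry A i j" by (subst sum.delta) (auto simp: finite_row)
    finally show "entry (A * 1) i j = entry A i j" .
  qed
  show "(A + B) * C = A * C + B * C"
  proof (rule rcf_matrix_eqI)
    fix i j
    let ?S = "{k. entry A i k \<noteq> 0} \<union> {k. entry B i k \<noteq> 0}"
    have fin: "finite ?S" by (simp add: finite_row)
    have "entry ((A + B) * C) i j = (\<Sum>k\<in>?S. entry (A + B) i k * entry C k j)"
      by (rule entry_times_sum[OF fin]) (auto simp: entry_simps)
    moreover have "entry (A * C) i j = (\<Sum>k\<in>?S. entry A i k * entry C k j)"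
      by (rule entry_times_sum[OF fin]) auto
    moreover have "entry (B * C) i j = (\<Sum>k\<in>?S. entry B i k * entry C k j)"
      by (rule entry_times_sum[OF fin]) auto
    ultimately show "entry ((A + B) * C) i j = entry (A * C + B * C) i j"
      by (simp add: plus_rcf_matrix.rep_eq distrib_right sum.distrib)
  qed
  show "A * (B + C) = A * B + A * C"
    by (rule rcf_matrix_eqI)
       (simp add: entry_times_row plus_rcf_matrix.rep_eq distrib_left sum.distrib)
  show "A * B * C = A * (B * C)"
  proof (rule rcf_matrix_eqI)
    fix i j
    let ?R = "{l. entry A i l \<noteq> 0}"
    let ?S = "\<Union>l\<in>?R. {k. entry B l k \<noteq> 0}"
    have fin: "finite ?S" by (auto simp: finite_row)
    have sub: "{k. entry (A * B) i k \<noteq> 0} \<subseteq> ?S"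
    proof
      fix k assume "k \<in> {k. entry (A * B) i k \<noteq> 0}"
      then have "(\<Sum>l\<in>?R. entry A i l * entry B l k) \<noteq> 0" by (simp add: entry_times_row)
      then obtain l where "l \<in> ?R" "entry A i l * entry B l k \<noteq> 0" by (rule sum.not_neutral_contains_not_neutral)
      then show "k \<in> ?S" by (auto dest: mult_not_zero)
    qed
    have "entry (A * B * C) i j = (\<Sum>k\<in>?S. (\<Sum>l\<in>?R. entry A i l * entry B l k) * entry C k j)"
      by (subst entry_times_sum[OF fin sub]) (simp add: entry_times_row)
    also have "\<dots> = (\<Sum>l\<in>?R. \<Sum>k\<in>?S. entry A i l * (entry B l k * entry C k j))"
      by (subst sum.swap) (simp add: sum_distrib_right mult.assoc)
    also have "\<dots> = (\<Sum>l\<in>?R. entry A i l * entry (B * C) l j)"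
    proof (rule sum.cong[OF refl])
      fix l assume "l \<in> ?R"
      then have "entry (B * C) l j = (\<Sum>k\<in>?S. entry B l k * entry C k j)"
        by (intro entry_times_sum[OF fin]) auto
      then show "(\<Sum>k\<in>?S. entry A i l * (entry B l k * entry C k j)) = entry A i l * entry (B * C) l j"
        by (simp add: sum_distrib_left)
    qed
    finally show "entry (A * B * C) i j = entry (A * (B * C)) i j"
      by (simp add: entry_times_row)
  qed
qed

end

lift_definition smult_rcf :: "'k::field \<Rightarrow> 'k rcf_matrix \<Rightarrow> 'k rcf_matrix"
  is "\<lambda>c A i j. c * A i j"
  by (auto intro: finite_subset[rotated])

definition finite_matrices :: "'k::zero rcf_matrix set"
  where "finite_matrices = {A. finite {(i, j). entry A i j \<noteq> 0}}"

section \<open>Algebras, ideals and homomorphisms\<close>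

text \<open>
  The class \<open>ring_1\<close> excludes the zero ring; an algebra with an ideal isomorphic to the finite
  matrices is never zero.
\<close>

locale unital_algebra = vector_space scale
  for scale :: "'k::field \<Rightarrow> 'e::ring_1 \<Rightarrow> 'e" +
  assumes scale_mult_left: "scale c x * y = scale c (x * y)"
    and scale_mult_right: "x * scale c y = scale c (x * y)"
begin

definition two_sided_ideal :: "'e set \<Rightarrow> bool"
  where "two_sided_ideal I \<longleftrightarrow>
    subspace I \<and> (\<forall>a. \<forall>x\<in>I. a * x \<in> I) \<and> (\<forall>a. \<forall>x\<in>I. x * a \<in> I)"

end

definition faithful_ideal :: "'e::ring_1 set \<Rightarrow> bool"
  where "faithful_ideal I \<longleftrightarrow>
    (\<forall>a. (\<lambda>x. a * x) ` I = {0} \<longrightarrow> a = 0) \<and> (\<forall>b. (\<lambda>x. x * b) ` I = {0} \<longrightarrow> b = 0)"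

definition unital_algebra_hom ::
  "('k::field \<Rightarrow> 'a::ring_1 \<Rightarrow> 'a) \<Rightarrow> ('k \<Rightarrow> 'b::ring_1 \<Rightarrow> 'b) \<Rightarrow> ('a \<Rightarrow> 'b) \<Rightarrow> bool"
  where "unital_algebra_hom scale1 scale2 f \<longleftrightarrow>
    Vector_Spaces.linear scale1 scale2 f \<and> (\<forall>x y. f (x * y) = f x * f y) \<and> f 1 = 1"

text \<open>
  An isomorphism of not necessarily unital algebras between the ideals \<open>I\<close> and \<open>J\<close>; only the
  values of \<open>f\<close> on \<open>I\<close> matter.
\<close>

definition algebra_iso_on ::
  "('k::field \<Rightarrow> 'a::ring_1 \<Rightarrow> 'a) \<Rightarrow> ('k \<Rightarrow> 'b::ring_1 \<Rightarrow> 'b) \<Rightarrow> 'a set \<Rightarrow> 'b set \<Rightarrow> ('a \<Rightarrow> 'b) \<Rightarrow> bool"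
  where "algebra_iso_on scale1 scale2 I J f \<longleftrightarrow>
    bij_betw f I J \<and>
    (\<forall>x\<in>I. \<forall>y\<in>I. f (x + y) = f x + f y) \<and>
    (\<forall>x\<in>I. \<forall>y\<in>I. f (x * y) = f x * f y) \<and>
    (\<forall>c. \<forall>x\<in>I. f (scale1 c x) = scale2 c (f x))"

lemma smult_rcf_times_left: "smult_rcf c A * B = smult_rcf c (A * B)"
proof (rule rcf_matrix_eqI)
  fix i j
  have "entry (smult_rcf c A * B) i j
      = (\<Sum>k | entry A i k \<noteq> 0. entry (smult_rcf c A) i k * entry B k j)"
    by (rule entry_times_sum[OF finite_row]) (auto simp: smult_rcf.rep_eq)
  then show "entry (smult_rcf c A * B) i j = entry (smult_rcf c (A * B)) i j"
    by (simp add: smult_rcf.rep_eq entry_times_row sum_distrib_left mult.assoc)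
qed

interpretation rcf: unital_algebra "smult_rcf :: 'k::field \<Rightarrow> 'k rcf_matrix \<Rightarrow> 'k rcf_matrix"
proof
  fix a b :: 'k and x y :: "'k rcf_matrix"
  show "smult_rcf a (x + y) = smult_rcf a x + smult_rcf a y"
    by (rule rcf_matrix_eqI) (simp add: smult_rcf.rep_eq plus_rcf_matrix.rep_eq distrib_left)
  show "smult_rcf (a + b) x = smult_rcf a x + smult_rcf b x"
    by (rule rcf_matrix_eqI) (simp add: smult_rcf.rep_eq plus_rcf_matrix.rep_eq distrib_right)
  show "smult_rcf a (smult_rcf b x) = smult_rcf (a * b) x"
    by (rule rcf_matrix_eqI) (simp add: smult_rcf.rep_eq mult.assoc)
  show "smult_rcf 1 x = x"
    by (rule rcf_matrix_eqI) (simp add: smult_rcf.rep_eq)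
  show "smult_rcf a x * y = smult_rcf a (x * y)"
    by (rule smult_rcf_times_left)
  show "x * smult_rcf a y = smult_rcf a (x * y)"
    by (rule rcf_matrix_eqI)
       (simp add: smult_rcf.rep_eq entry_times_row sum_distrib_left mult.left_commute)
qed

lemma finite_matrices_ideal: "rcf.two_sided_ideal (finite_matrices :: 'k::field rcf_matrix set)"
proof -
  let ?supp = "\<lambda>A :: 'k rcf_matrix. {(i, j). entry A i j \<noteq> 0}"
  have sub: "?supp (A + B) \<subseteq> ?supp A \<union> ?supp B" "?supp (smult_rcf c A) \<subseteq> ?supp A" for A B c
    by (auto simp: plus_rcf_matrix.rep_eq smult_rcf.rep_eq)
  have prod: "\<exists>k. entry A i k \<noteq> 0 \<and> entry B k j \<noteq> 0" if "entry (A * B) i j \<noteq> 0"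
    for A B :: "'k rcf_matrix" and i j
    using that unfolding entry_times_row by (rule sum.not_neutral_contains_not_neutral) auto
  have left: "finite (?supp (A * X))" if X: "finite (?supp X)" for A X
  proof (rule finite_subset)
    show "?supp (A * X) \<subseteq> (\<Union>(k, j)\<in>?supp X. (\<lambda>i. (i, j)) ` {i. entry A i k \<noteq> 0})"
      by (fastforce dest: prod)
    show "finite (\<Union>(k, j)\<in>?supp X. (\<lambda>i. (i, j)) ` {i. entry A i k \<noteq> 0})"
      using X by (auto simp: finite_col)
  qed
  have right: "finite (?supp (X * A))" if X: "finite (?supp X)" for A X
  proof (rule finite_subset)
    show "?supp (X * A) \<subseteq> (\<Union>(i, k)\<in>?supp X. (\<lambda>j. (i, j)) ` {j. entry A k j \<noteq> 0})"
      by (fastforce dest: prod)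
    show "finite (\<Union>(i, k)\<in>?supp X. (\<lambda>j. (i, j)) ` {j. entry A k j \<noteq> 0})"
      using X by (auto simp: finite_row)
  qed
  show ?thesis
    unfolding rcf.two_sided_ideal_def rcf.subspace_def finite_matrices_def mem_Collect_eq
    using left right by (auto intro: finite_subset[OF sub(1)] finite_subset[OF sub(2)]
        simp: zero_rcf_matrix.rep_eq)
qed

end

theory Submission
  imports Defs
begin

text \<open>
  Everything rests on the fact that a matrix in \<open>B(K)\<close> is determined by its products with the finite
  matrices, on either side: multiplying by a diagonal matrix unit extracts a column or a row
  (\<open>rcf_matrix_eqI_right\<close>, \<open>rcf_matrix_eqI_left\<close>).  A homomorphism \<open>\<phi>\<close> extending \<open>\<iota>\<close> must satisfy
  \<open>\<phi> a * \<iota> x = \<iota> (a * x)\<close> for all \<open>x\<close> in \<open>M\<close>, and since the right-hand side only involves \<open>\<iota>\<close>, this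
  determines \<open>\<phi> a\<close>.  Conversely, any function satisfying it is automatically a
  unital homomorphism extending \<open>\<iota>\<close>, because both sides of each required identity act in the same way
  on the finite matrices (\<open>hom_if_acts\<close>).

  It remains to construct for each \<open>a\<close> a matrix acting as left multiplication by \<open>a\<close> on \<open>M\<close>.  Let
  \<open>u i\<close> in \<open>M\<close> correspond to the matrix unit \<open>E\<^sub>i\<^sub>i\<close>.  The \<open>i\<close>-th row of the matrix for \<open>a\<close> has to be the \<open>i\<close>-th
  row of \<open>\<iota> (u i * a)\<close>, and its \<open>j\<close>-th column has to be the \<open>j\<close>-th column of \<open>\<iota> (a * u j)\<close>.  These
  prescriptions agree because both entries can be read off from \<open>u i * a * u j\<close>.  The first shows that
  rows are finite, the second that columns are (\<open>entry_extension\<close>).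

  For the last claim, \<open>\<phi> a * \<iota> x = \<iota> (a * x)\<close> and \<open>\<iota> x * \<phi> a = \<iota> (x * a)\<close> show that the kernel of \<open>\<phi>\<close>
  is both the left and the right annihilator of \<open>M\<close> (\<open>kernel_eq_left_annihilator\<close>,
  \<open>kernel_eq_right_annihilator\<close>).  Faithfulness says that these two annihilators vanish.
\<close>

section \<open>Finite matrices separate the elements of \<open>B(K)\<close>\<close>

lift_definition diag_unit :: "pos \<Rightarrow> 'k::ring_1 rcf_matrix"
  is "\<lambda>p i j. if i = p \<and> j = p then 1 else 0"
  by simp

lemma diag_unit_finite: "diag_unit p \<in> finite_matrices"
  unfolding finite_matrices_def mem_Collect_eq
  by (rule finite_subset[of _ "{(p, p)}"]) (auto simp: diag_unit.rep_eq split: if_splits)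

lemma entry_diag_unit_times:
  "entry (diag_unit p * A) i j = (if i = p then entry A p j else 0)"
proof -
  have "entry (diag_unit p * A) i j = (\<Sum>k\<in>{p}. entry (diag_unit p) i k * entry A k j)"
    by (rule entry_times_sum) (auto simp: diag_unit.rep_eq split: if_splits)
  then show ?thesis by (simp add: diag_unit.rep_eq)
qed

lemma entry_times_diag_unit:
  "entry (A * diag_unit p) i j = (if j = p then entry A i p else 0)"
proof -
  let ?S = "insert p {k. entry A i k \<noteq> 0}"
  have "entry (A * diag_unit p) i j = (\<Sum>k\<in>?S. entry A i k * entry (diag_unit p) k j)"
    by (rule entry_times_sum) (auto simp: finite_row)
  also have "\<dots> = (\<Sum>k\<in>?S. if k = p then (if j = p then entry A i k else 0) else 0)"
    by (rule sum.cong) (auto simp: diag_unit.rep_eq)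
  also have "\<dots> = (if j = p then entry A i p else 0)"
    by (subst sum.delta) (auto simp: finite_row)
  finally show ?thesis .
qed

lemma rcf_matrix_eqI_right:
  assumes "\<And>X. X \<in> finite_matrices \<Longrightarrow> A * X = B * X"
  shows "A = B"
proof (rule rcf_matrix_eqI)
  fix i j
  have "entry (A * diag_unit j) i j = entry (B * diag_unit j) i j"
    by (simp add: assms diag_unit_finite)
  then show "entry A i j = entry B i j" by (simp add: entry_times_diag_unit)
qed

lemma rcf_matrix_eqI_left:
  assumes "\<And>X. X \<in> finite_matrices \<Longrightarrow> X * A = X * B"
  shows "A = B"
proof (rule rcf_matrix_eqI)
  fix i j
  have "entry (diag_unit i * A) i j = entry (diag_unit i * B) i j"
    by (simp add: assms diag_unit_finite)
  then show "entry A i j = entry B i j" by (simp add: entry_diag_unit_times)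
qed

section \<open>Extending an isomorphism from the ideal to the whole algebra\<close>

locale finite_matrix_ideal = unital_algebra scale
  for scale :: "'k::field \<Rightarrow> 'e::ring_1 \<Rightarrow> 'e" +
  fixes M :: "'e set" and \<iota> :: "'e \<Rightarrow> 'k rcf_matrix"
  assumes ideal: "two_sided_ideal M"
    and iso: "algebra_iso_on scale smult_rcf M finite_matrices \<iota>"
begin

lemma zero_mem: "0 \<in> M"
  and mult_mem_left: "x \<in> M \<Longrightarrow> a * x \<in> M"
  and mult_mem_right: "x \<in> M \<Longrightarrow> x * a \<in> M"
  using ideal unfolding two_sided_ideal_def subspace_def by auto

lemma iota_bij: "bij_betw \<iota> M finite_matrices"
  and iota_add: "x \<in> M \<Longrightarrow> y \<in> M \<Longrightarrow> \<iota> (x + y) = \<iota> x + \<iota> y"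
  and iota_mult: "x \<in> M \<Longrightarrow> y \<in> M \<Longrightarrow> \<iota> (x * y) = \<iota> x * \<iota> y"
  and iota_scale: "x \<in> M \<Longrightarrow> \<iota> (scale c x) = smult_rcf c (\<iota> x)"
  using iso unfolding algebra_iso_on_def by auto

lemma iota_0: "\<iota> 0 = 0"
  using iota_add[OF zero_mem zero_mem] by simp

lemma iota_eq_0_iff: "x \<in> M \<Longrightarrow> \<iota> x = 0 \<longleftrightarrow> x = 0"
  using inj_on_eq_iff[OF bij_betw_imp_inj_on[OF iota_bij] _ zero_mem] iota_0 by simp

lemma finite_matrix_obtain:
  assumes "X \<in> finite_matrices"
  obtains x where "x \<in> M" "X = \<iota> x"
  using assms iota_bij unfolding bij_betw_def by blast

lemma eq_if_right_iota:
  assumes "\<And>x. x \<in> M \<Longrightarrow> A * \<iota> x = B * \<iota> x"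
  shows "A = B"
  by (rule rcf_matrix_eqI_right) (auto elim!: finite_matrix_obtain simp: assms)

lemma eq_if_left_iota:
  assumes "\<And>x. x \<in> M \<Longrightarrow> \<iota> x * A = \<iota> x * B"
  shows "A = B"
  by (rule rcf_matrix_eqI_left) (auto elim!: finite_matrix_obtain simp: assms)

abbreviation extends_iota :: "('e \<Rightarrow> 'k rcf_matrix) \<Rightarrow> bool"
  where "extends_iota \<phi> \<equiv> unital_algebra_hom scale smult_rcf \<phi> \<and> (\<forall>x\<in>M. \<phi> x = \<iota> x)"

lemma hom_acts_left:
  assumes "extends_iota \<phi>" "x \<in> M"
  shows "\<phi> a * \<iota> x = \<iota> (a * x)"
proof -
  have "\<phi> (a * x) = \<phi> a * \<phi> x"
    using assms unfolding unital_algebra_hom_def by blast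
  then show ?thesis using assms mult_mem_left by simp
qed

lemma hom_acts_right:
  assumes "extends_iota \<phi>" "x \<in> M"
  shows "\<iota> x * \<phi> a = \<iota> (x * a)"
proof -
  have "\<phi> (x * a) = \<phi> x * \<phi> a"
    using assms unfolding unital_algebra_hom_def by blast
  then show ?thesis using assms mult_mem_right by simp
qed

text \<open>
  Each identity between matrices required of a homomorphism holds because both sides act in the
  same way on every \<open>\<iota> x\<close>, where it becomes the corresponding identity in the algebra.
\<close>

lemma hom_if_acts:
  assumes acts: "\<And>a x. x \<in> M \<Longrightarrow> \<phi> a * \<iota> x = \<iota> (a * x)"
  shows "extends_iota \<phi>"
proof -
  have "\<phi> (a + b) = \<phi> a + \<phi> b" for a b
    by (rule eq_if_right_iota) (simp add: acts distrib_right iota_add mult_mem_left)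
  moreover have "\<phi> (scale c a) = smult_rcf c (\<phi> a)" for c a
    by (rule eq_if_right_iota)
       (simp add: acts smult_rcf_times_left scale_mult_left iota_scale mult_mem_left)
  moreover have "\<phi> (a * b) = \<phi> a * \<phi> b" for a b
    by (rule eq_if_right_iota) (simp add: acts mult.assoc mult_mem_left)
  moreover have "\<phi> 1 = 1"
    by (rule eq_if_right_iota) (simp add: acts)
  moreover have "\<phi> x = \<iota> x" if "x \<in> M" for x
    by (rule eq_if_right_iota) (simp add: acts iota_mult that)
  ultimately show ?thesis
    unfolding unital_algebra_hom_def Vector_Spaces.linear_iff
    using vector_space_axioms rcf.vector_space_axioms by blast
qed

definition u :: "pos \<Rightarrow> 'e"
  where "u i = inv_into M \<iota> (diag_unit i)"

lemma u_mem: "u i \<in> M"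
  and iota_u: "\<iota> (u i) = diag_unit i"
proof -
  have i: "diag_unit i \<in> \<iota> ` M"
    using iota_bij diag_unit_finite by (simp add: bij_betw_def)
  show "u i \<in> M" "\<iota> (u i) = diag_unit i"
    unfolding u_def by (rule inv_into_into[OF i], rule f_inv_into_f[OF i])
qed

text \<open>
  Both sides are the \<open>(i, j)\<close> entry of \<open>\<iota> (u i * a * u j)\<close>.
\<close>

lemma row_eq_column:
  "entry (\<iota> (u i * a)) i j = entry (\<iota> (a * u j)) i j"
proof -
  have "\<iota> (u i * a) * diag_unit j = diag_unit i * \<iota> (a * u j)"
    by (simp add: iota_u[symmetric] iota_mult[symmetric] u_mem mult_mem_left mult_mem_right mult.assoc)
  then have "entry (\<iota> (u i * a) * diag_unit j) i j = entry (diag_unit i * \<iota> (a * u j)) i j"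
    by simp
  then show ?thesis by (simp add: entry_times_diag_unit entry_diag_unit_times)
qed

definition extension :: "'e \<Rightarrow> 'k rcf_matrix"
  where "extension a = Rcf_Matrix (\<lambda>i j. entry (\<iota> (u i * a)) i j)"

lemma entry_extension: "entry (extension a) i j = entry (\<iota> (u i * a)) i j"
proof -
  have "finite {j. entry (\<iota> (u i * a)) i j \<noteq> 0}" for i
    by (rule finite_row)
  moreover have "finite {i. entry (\<iota> (u i * a)) i j \<noteq> 0}" for j
    unfolding row_eq_column by (rule finite_col)
  ultimately show ?thesis
    unfolding extension_def by (simp add: Rcf_Matrix_inverse)
qed

text \<open>
  The \<open>i\<close>-th row of a product only depends on the \<open>i\<close>-th row of the left factor, so there
  \<open>extension a\<close> may be replaced by \<open>\<iota> (u i * a)\<close>, which lies in the domain where \<open>\<iota>\<close> is multiplicative.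
\<close>

lemma extension_acts:
  assumes x: "x \<in> M"
  shows "extension a * \<iota> x = \<iota> (a * x)"
proof (rule rcf_matrix_eqI)
  fix i j
  have "entry (extension a * \<iota> x) i j = entry (\<iota> (u i * a) * \<iota> x) i j"
    by (simp add: entry_times_row entry_extension)
  also have "\<iota> (u i * a) * \<iota> x = diag_unit i * \<iota> (a * x)"
    by (simp add: iota_u[symmetric] iota_mult[symmetric] u_mem mult_mem_left mult_mem_right x mult.assoc)
  also have "entry \<dots> i j = entry (\<iota> (a * x)) i j"
    by (simp add: entry_diag_unit_times)
  finally show "entry (extension a * \<iota> x) i j = entry (\<iota> (a * x)) i j" .
qed

lemma unique_extension: "\<exists>!\<phi>. extends_iota \<phi>"
proof (rule ex_ex1I)
  show "\<exists>\<phi>. extends_iota \<phi>"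
    using hom_if_acts[of extension] extension_acts by blast
next
  fix \<phi> \<psi> assume hom: "extends_iota \<phi>" "extends_iota \<psi>"
  have "\<phi> a = \<psi> a" for a
    by (rule eq_if_right_iota) (simp add: hom_acts_left[OF hom(1)] hom_acts_left[OF hom(2)])
  then show "\<phi> = \<psi>" by (rule ext)
qed

section \<open>The kernel of the extension\<close>

lemma kernel_eq_left_annihilator:
  assumes "extends_iota \<phi>"
  shows "\<phi> a = 0 \<longleftrightarrow> (\<forall>x\<in>M. a * x = 0)"
proof
  assume "\<phi> a = 0"
  then show "\<forall>x\<in>M. a * x = 0"
    using hom_acts_left[OF assms, of _ a] iota_eq_0_iff mult_mem_left by force
next
  assume zero: "\<forall>x\<in>M. a * x = 0"
  show "\<phi> a = 0"
    by (rule eq_if_right_iota) (simp add: hom_acts_left[OF assms] zero iota_0)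
qed

lemma kernel_eq_right_annihilator:
  assumes "extends_iota \<phi>"
  shows "\<phi> a = 0 \<longleftrightarrow> (\<forall>x\<in>M. x * a = 0)"
proof
  assume "\<phi> a = 0"
  then show "\<forall>x\<in>M. x * a = 0"
    using hom_acts_right[OF assms, of _ a] iota_eq_0_iff mult_mem_right by force
next
  assume zero: "\<forall>x\<in>M. x * a = 0"
  show "\<phi> a = 0"
    by (rule eq_if_left_iota) (simp add: hom_acts_right[OF assms] zero iota_0)
qed

lemma inj_iff_faithful:
  assumes \<phi>: "extends_iota \<phi>"
  shows "inj \<phi> \<longleftrightarrow> faithful_ideal M"
proof -
  have "inj \<phi> \<longleftrightarrow> (\<forall>a. \<phi> a = 0 \<longrightarrow> a = 0)"
    using \<phi> unfolding unital_algebra_hom_def Vector_Spaces.linear_def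
    by (intro module_hom.inj_iff_eq_0[of scale smult_rcf]) simp
  moreover have "f ` M = {0} \<longleftrightarrow> (\<forall>x\<in>M. f x = 0)" for f :: "'e \<Rightarrow> 'e"
    using zero_mem by auto
  ultimately show ?thesis
    unfolding faithful_ideal_def
    using kernel_eq_left_annihilator[OF \<phi>] kernel_eq_right_annihilator[OF \<phi>] by simp
qed

end

theorem lemma3p1:
  fixes scaleE :: "'k::field_char_0 \<Rightarrow> 'e::ring_1 \<Rightarrow> 'e"
    and M :: "'e set"
    and \<iota> :: "'e \<Rightarrow> 'k rcf_matrix"
  assumes "unital_algebra scaleE"
    and "unital_algebra.two_sided_ideal scaleE M"
    and "algebra_iso_on scaleE smult_rcf M finite_matrices \<iota>"
  shows "(\<exists>!\<phi>. unital_algebra_hom scaleE smult_rcf \<phi> \<and> (\<forall>x\<in>M. \<phi> x = \<iota> x)) \<and>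
    (\<forall>\<phi>. unital_algebra_hom scaleE smult_rcf \<phi> \<and> (\<forall>x\<in>M. \<phi> x = \<iota> x) \<longrightarrow>
      (inj \<phi> \<longleftrightarrow> faithful_ideal M))"
proof -
  interpret finite_matrix_ideal scaleE M \<iota>
    using assms by (simp add: finite_matrix_ideal_def finite_matrix_ideal_axioms_def)
  show ?thesis
    using unique_extension inj_iff_faithful by blast
qed

end
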